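(* Let $G_\bullet$ be a vertex-stable $\mathrm{FI}$-graph. Then for all $n \gg 0$ (that is, for all $n$ larger than some constant depending only on $G_\bullet$ and, in item 4, also on $r$): 1. every transition map originating from $G_n$, i.e. every $G(f):G_n\to G_m$ with $f:[n]\hookrightarrow[m]$ an injection, is injective (on vertices); 2. every transition map originating from $G_n$ has image which is an induced subgraph of its target; 3. every edge of $G_{n+1}$ is the image of some edge of $G_n$ under some transition map $G(f)$, $f:[n]\hookrightarrow[n+1]$; 4. for any fixed $r \geq 1$ and any collection $\{v_1,\ldots,v_r\}$ of $r$ vertices of $G_{n+1}$, there exists a collection $\{w_1,\ldots,w_r\}$ of $r$ vertices of $G_n$ and an injection $f:[n]\hookrightarrow[n+1]$ such that $G(f)$ maps $\{w_1,\ldots,w_r\}$ to $\{v_1,\ldots,v_r\}$.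
   Context: Graphs are finite and simple (no multi-edges, no self-loops), possibly disconnected. A homomorphism of graphs $\phi:G\to G'$ is a map $V(G)\to V(G')$ such that $\{x,y\}\in E(G)$ implies $\{\phi(x),\phi(y)\}\in E(G')$. Let $[n]=\{1,\dots,n\}$, and let $\mathrm{FI}$ be the category with objects $[n]$, $n\ge 0$, and morphisms all injections. An $\mathrm{FI}$-graph $G_\bullet$ is a functor from $\mathrm{FI}$ to the category of graphs and graph homomorphisms; $G_n$ is its value on $[n]$, and the maps $G(f)$ induced by injections $f$ are called transition maps. $G_\bullet$ is vertex-stable with stable degree $\le d$ if for all $n\ge d$ and every $v\in V(G_{n+1})$ there exist $w\in V(G_n)$ and an injection $f:[n]\hookrightarrow[n+1]$ with $G(f)(w)=v$; it is vertex-stable if this holds for some $d$. The image of a graph homomorphism is the subgraph formed by the images of the vertices and the images of the edges. A subgraph $G'\subseteq G$ is induced if for all $x,y\in V(G')$, $\{x,y\}\in E(G)$ implies $\{x,y\}\in E(G')$. *)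

theory Defs
  imports Main "HOL-Library.FuncSet"
begin

record 'a sgraph =
  vertices :: "'a set"
  edges :: "'a set set"

text \<open>A finite simple graph; since an edge is a two-element set of vertices, loops and multiple
  edges are excluded.\<close>

definition simple_graph :: "'a sgraph \<Rightarrow> bool" where
  "simple_graph H \<longleftrightarrow>
     finite (vertices H) \<and> (\<forall>e\<in>edges H. e \<subseteq> vertices H \<and> card e = 2)"

definition graph_hom :: "'a sgraph \<Rightarrow> 'b sgraph \<Rightarrow> ('a \<Rightarrow> 'b) \<Rightarrow> bool" where
  "graph_hom H H' \<phi> \<longleftrightarrow>
     \<phi> \<in> vertices H \<rightarrow> vertices H' \<and>
     (\<forall>x y. {x, y} \<in> edges H \<longrightarrow> {\<phi> x, \<phi> y} \<in> edges H')"

definition graph_image :: "('a \<Rightarrow> 'b) \<Rightarrow> 'a sgraph \<Rightarrow> 'b sgraph" where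
  "graph_image \<phi> H = \<lparr>vertices = \<phi> ` vertices H, edges = (\<lambda>e. \<phi> ` e) ` edges H\<rparr>"

definition subgraph :: "'a sgraph \<Rightarrow> 'a sgraph \<Rightarrow> bool" where
  "subgraph H' H \<longleftrightarrow>
     simple_graph H' \<and> vertices H' \<subseteq> vertices H \<and> edges H' \<subseteq> edges H"

definition induced_subgraph :: "'a sgraph \<Rightarrow> 'a sgraph \<Rightarrow> bool" where
  "induced_subgraph H' H \<longleftrightarrow>
     subgraph H' H \<and>
     (\<forall>x\<in>vertices H'. \<forall>y\<in>vertices H'. {x, y} \<in> edges H \<longrightarrow> {x, y} \<in> edges H')"

text \<open>The morphisms from \<open>[n]\<close> to \<open>[m]\<close> in the category FI. They are taken extensional, so that
  each injection is represented by exactly one function on \<^typ>\<open>nat\<close>; composition and identities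
  are accordingly \<^const>\<open>compose\<close> and restricted identity functions.\<close>

definition FI_hom :: "nat \<Rightarrow> nat \<Rightarrow> (nat \<Rightarrow> nat) set" where
  "FI_hom n m = {f \<in> {1..n} \<rightarrow>\<^sub>E {1..m}. inj_on f {1..n}}"

text \<open>A functor from FI to graphs: \<open>G n\<close> is its value on \<open>[n]\<close>, and \<open>T n m f\<close> is the map induced
  by \<open>f \<in> FI_hom n m\<close>. Only the values of \<open>T n m f\<close> on the vertices of \<open>G n\<close> are relevant.\<close>

locale FI_graph =
  fixes G :: "nat \<Rightarrow> 'a sgraph"
    and T :: "nat \<Rightarrow> nat \<Rightarrow> (nat \<Rightarrow> nat) \<Rightarrow> 'a \<Rightarrow> 'a"
  assumes graph: "simple_graph (G n)"
    and hom: "f \<in> FI_hom n m \<Longrightarrow> graph_hom (G n) (G m) (T n m f)"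
    and identity: "v \<in> vertices (G n) \<Longrightarrow> T n n (\<lambda>i\<in>{1..n}. i) v = v"
    and composition: "\<lbrakk>f \<in> FI_hom n m; g \<in> FI_hom m k; v \<in> vertices (G n)\<rbrakk>
      \<Longrightarrow> T n k (compose {1..n} g f) v = T m k g (T n m f v)"

definition stable_degree_le ::
  "(nat \<Rightarrow> 'a sgraph) \<Rightarrow> (nat \<Rightarrow> nat \<Rightarrow> (nat \<Rightarrow> nat) \<Rightarrow> 'a \<Rightarrow> 'a) \<Rightarrow> nat \<Rightarrow> bool" where
  "stable_degree_le G T d \<longleftrightarrow>
     (\<forall>n\<ge>d. \<forall>v\<in>vertices (G (n + 1)).
        \<exists>w\<in>vertices (G n). \<exists>f\<in>FI_hom n (n + 1). T n (n + 1) f w = v)"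

definition vertex_stable ::
  "(nat \<Rightarrow> 'a sgraph) \<Rightarrow> (nat \<Rightarrow> nat \<Rightarrow> (nat \<Rightarrow> nat) \<Rightarrow> 'a \<Rightarrow> 'a) \<Rightarrow> bool" where
  "vertex_stable G T \<longleftrightarrow> (\<exists>d. stable_degree_le G T d)"

end

theory Submission imports Defs begin

text \<open>Write \<open>d\<close> for the stable degree. A set of \<open>r\<close> vertices of \<open>G n\<close> arises from \<open>r\<close> injections
  \<open>[d] \<rightarrow> [n]\<close>, whose images together have at most \<open>d * r\<close> elements, so for \<open>n \<ge> d * r\<close> all \<open>r\<close> vertices
  lie in the image of a single transition map from \<open>G (d * r)\<close>. Factoring that injection
  \<open>[d * r] \<rightarrow> [n + 1]\<close> through \<open>[n]\<close> gives item 4. For \<open>r = 2\<close>, any question about a pair of vertices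
  of \<open>G n\<close> is thus one about the finitely many pairs of vertices of \<open>G (2 * d)\<close>. Equality and
  adjacency are preserved by transition maps, so each such pair, once related at some level, is related
  at all later levels under all transition maps; hence from some level on both relations are
  also reflected, which is items 1 and 2. Item 3 combines the case \<open>r = 2\<close> of item 4 with item 2.\<close>

section \<open>Factorization of injections\<close>

lemma FI_homI:
  assumes "f \<in> extensional {1..n}" "f ` {1..n} \<subseteq> {1..m}" "inj_on f {1..n}"
  shows "f \<in> FI_hom n m"
  using assms by (auto simp: FI_hom_def PiE_def)

lemma FI_hom_extensional: "f \<in> FI_hom n m \<Longrightarrow> f \<in> extensional {1..n}"
  by (auto simp: FI_hom_def PiE_def)

lemma FI_hom_image: "f \<in> FI_hom n m \<Longrightarrow> f ` {1..n} \<subseteq> {1..m}"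
  by (auto simp: FI_hom_def)

lemma FI_hom_inj: "f \<in> FI_hom n m \<Longrightarrow> inj_on f {1..n}"
  by (simp add: FI_hom_def)

lemma FI_hom_card_image: "f \<in> FI_hom n m \<Longrightarrow> card (f ` {1..n}) = n"
  using card_image[OF FI_hom_inj] by simp

lemma FI_hom_inclusion: "n \<le> m \<Longrightarrow> (\<lambda>i\<in>{1..n}. i) \<in> FI_hom n m"
  by (auto simp: FI_hom_def inj_on_def)

lemma FI_hom_compose:
  assumes "f \<in> FI_hom n m" "g \<in> FI_hom m k"
  shows "compose {1..n} g f \<in> FI_hom n k"
proof (rule FI_homI)
  show "compose {1..n} g f ` {1..n} \<subseteq> {1..k}"
    using FI_hom_image[OF assms(1)] FI_hom_image[OF assms(2)] by (auto simp: compose_eq)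
  have "inj_on (g \<circ> f) {1..n}"
    by (rule comp_inj_on[OF FI_hom_inj[OF assms(1)]
        inj_on_subset[OF FI_hom_inj[OF assms(2)] FI_hom_image[OF assms(1)]]])
  then show "inj_on (compose {1..n} g f) {1..n}"
    by (subst inj_on_cong[where g = "g \<circ> f"]) (simp_all add: compose_eq)
qed simp

text \<open>The factor is \<open>f\<close> followed by the inverse of \<open>c\<close> on its image.
  It moves a vertex that comes from \<open>f\<close> into the image of the transition map of
  \<open>c\<close>.\<close>

lemma FI_hom_factor_image:
  assumes f: "f \<in> FI_hom k n" and c: "c \<in> FI_hom l n" and sub: "f ` {1..k} \<subseteq> c ` {1..l}"
  obtains g where "g \<in> FI_hom k l" "f = compose {1..k} c g"
proof
  define g where "g = (\<lambda>i\<in>{1..k}. inv_into {1..l} c (f i))"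
  have f_mem: "f i \<in> c ` {1..l}" if "i \<in> {1..k}" for i
    using that sub by blast
  have g_mem: "g i \<in> {1..l}" and cg: "c (g i) = f i" if "i \<in> {1..k}" for i
    using that inv_into_into[OF f_mem[OF that]] f_inv_into_f[OF f_mem[OF that]]
    by (simp_all add: g_def)
  show "g \<in> FI_hom k l"
  proof (rule FI_homI)
    show "inj_on g {1..k}"
      using FI_hom_inj[OF f] cg by (metis inj_on_def)
  qed (use g_mem in \<open>auto simp: g_def\<close>)
  show "f = compose {1..k} c g"
    by (rule extensionalityI[of _ "{1..k}"])
      (use FI_hom_extensional[OF f] cg in \<open>auto simp: compose_eq\<close>)
qed

text \<open>The values of \<open>h\<close> on the image of \<open>f\<close> are forced, and the
  other \<open>n - k\<close> points fit injectively into the \<open>m - k\<close> points that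
  \<open>g\<close> misses because \<open>n \<le> m\<close>. With \<open>f\<close> an inclusion this
  factors an injection through \<open>[n]\<close>; in general it makes any injection from
  \<open>[k]\<close> to a later level factor through any earlier one.\<close>

lemma FI_hom_extend:
  assumes f: "f \<in> FI_hom k n" and g: "g \<in> FI_hom k m" and "n \<le> m"
  obtains h where "h \<in> FI_hom n m" "g = compose {1..k} h f"
proof -
  have "card ({1..n} - f ` {1..k}) \<le> card ({1..m} - g ` {1..k})"
    using FI_hom_image[OF f] FI_hom_image[OF g] FI_hom_card_image[OF f] FI_hom_card_image[OF g]
      \<open>n \<le> m\<close> by (simp add: card_Diff_subset)
  then obtain p where p: "p ` ({1..n} - f ` {1..k}) \<subseteq> {1..m} - g ` {1..k}"
      "inj_on p ({1..n} - f ` {1..k})"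
    by (metis card_le_inj finite_Diff finite_atLeastAtMost)
  define h where
    "h = (\<lambda>j\<in>{1..n}. if j \<in> f ` {1..k} then g (inv_into {1..k} f j) else p j)"
  have hf: "h (f i) = g i" if "i \<in> {1..k}" for i
  proof -
    have "f i \<in> {1..n}"
      using that FI_hom_image[OF f] by blast
    then show ?thesis
      using that FI_hom_inj[OF f] by (simp add: h_def)
  qed
  have hp: "h j = p j" if "j \<in> {1..n} - f ` {1..k}" for j
    using that by (auto simp: h_def)
  have split: "{1..n} = f ` {1..k} \<union> ({1..n} - f ` {1..k})"
    using FI_hom_image[OF f] by blast
  have im1: "h ` f ` {1..k} = g ` {1..k}"
    using hf by (auto simp: image_image)
  have im2: "h ` ({1..n} - f ` {1..k}) = p ` ({1..n} - f ` {1..k})"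
    using hp by (intro image_cong) auto
  \<comment> \<open>On \<open>{1..k}\<close> the composite agrees with the injection
    \<open>g\<close>, which forces \<open>h\<close> to be injective on the image of
    \<open>f\<close>.\<close>
  have "inj_on (h \<circ> f) {1..k}"
    using FI_hom_inj[OF g] hf by (subst inj_on_cong[where g = g]) auto
  then have inj1: "inj_on h (f ` {1..k})"
    by (rule inj_on_imageI)
  have inj2: "inj_on h ({1..n} - f ` {1..k})"
    using p(2) hp by (subst inj_on_cong[where g = p])
  show ?thesis
  proof
    show "h \<in> FI_hom n m"
    proof (rule FI_homI)
      show "h ` {1..n} \<subseteq> {1..m}"
        unfolding arg_cong[OF split, of "image h"] image_Un im1 im2
        using p(1) FI_hom_image[OF g] by blast
      have "h ` f ` {1..k} \<inter> h ` ({1..n} - f ` {1..k}) = {}"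
        unfolding im1 im2 using p(1) by blast
      then have "inj_on h (f ` {1..k} \<union> ({1..n} - f ` {1..k}))"
        unfolding inj_on_Un using inj1 inj2 by blast
      then show "inj_on h {1..n}"
        by (simp only: split[symmetric])
    qed (simp add: h_def)
    show "g = compose {1..k} h f"
      by (rule extensionalityI[of _ "{1..k}"])
        (use FI_hom_extensional[OF g] hf in \<open>auto simp: compose_eq\<close>)
  qed
qed

text \<open>Enlarge \<open>U\<close> to exactly \<open>l\<close> elements of \<open>[n]\<close> and
  enumerate the result.\<close>

lemma FI_hom_onto_superset:
  assumes "U \<subseteq> {1..n}" "card U \<le> l" "l \<le> n"
  obtains c where "c \<in> FI_hom l n" "U \<subseteq> c ` {1..l}"
proof -
  obtain U' where U': "U \<subseteq> U'" "U' \<subseteq> {1..n}" "card U' = l"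
    using exists_subset_between[of U l "{1..n}"] assms by auto
  then obtain c where c: "bij_betw c {1..l} U'"
    by (metis card_atLeastAtMost diff_Suc_1 finite_atLeastAtMost finite_subset
        finite_same_card_bij)
  show ?thesis
  proof
    show "restrict c {1..l} \<in> FI_hom l n"
      using c U'(2) by (intro FI_homI) (auto simp: bij_betw_def)
    show "U \<subseteq> restrict c {1..l} ` {1..l}"
      using c U'(1) by (auto simp: bij_betw_def)
  qed
qed

section \<open>Vertices and relations at large degree\<close>

context FI_graph
begin

lemma T_vertex: "f \<in> FI_hom n m \<Longrightarrow> v \<in> vertices (G n) \<Longrightarrow> T n m f v \<in> vertices (G m)"
  using hom by (auto simp: graph_hom_def)

lemma T_edge:
  "f \<in> FI_hom n m \<Longrightarrow> {x, y} \<in> edges (G n) \<Longrightarrow> {T n m f x, T n m f y} \<in> edges (G m)"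
  using hom by (auto simp: graph_hom_def)

lemma edgeE:
  assumes "e \<in> edges (G n)"
  obtains x y where "e = {x, y}" "x \<noteq> y" "x \<in> vertices (G n)" "y \<in> vertices (G n)"
proof -
  have "e \<subseteq> vertices (G n)" "card e = 2"
    using assms graph[of n] by (auto simp: simple_graph_def)
  then show ?thesis using that by (auto simp: card_2_iff)
qed

text \<open>Stability speaks of one step from \<open>n\<close> to \<open>n + 1\<close>; induction
  composes the steps from level \<open>d\<close> upwards.\<close>

lemma generated_in_degree:
  assumes stable: "stable_degree_le G T d" and "n \<ge> d" and "v \<in> vertices (G n)"
  shows "\<exists>w\<in>vertices (G d). \<exists>f\<in>FI_hom d n. T d n f w = v"
  using assms(2,3)
proof (induction n arbitrary: v rule: dec_induct)
  case base
  then show ?case using identity FI_hom_inclusion by blast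
next
  case (step n)
  obtain u g where u: "u \<in> vertices (G n)" "g \<in> FI_hom n (Suc n)" "T n (Suc n) g u = v"
    using stable step.hyps step.prems unfolding stable_degree_le_def by fastforce
  obtain w f where "w \<in> vertices (G d)" "f \<in> FI_hom d n" "T d n f w = u"
    using step.IH[OF u(1)] by blast
  then show ?case
    using u composition[of f d n g] FI_hom_compose[of f d n g] by metis
qed

text \<open>Each vertex of \<open>S\<close> comes from an injection of \<open>[d]\<close>, and the
  union of their images has at most \<open>d * r\<close> points. An injection of
  \<open>[d * r]\<close> covering that union factors all of them.\<close>

lemma common_source:
  assumes stable: "stable_degree_le G T d" and "S \<subseteq> vertices (G n)" "card S \<le> r"
    and "d * r \<le> n" "1 \<le> r"
  obtains c where "c \<in> FI_hom (d * r) n" "S \<subseteq> T (d * r) n c ` vertices (G (d * r))"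
proof -
  have "finite S"
    using assms(2) graph[of n] by (auto simp: simple_graph_def intro: finite_subset)
  have "d \<le> d * r"
    using \<open>1 \<le> r\<close> by simp
  then have "d \<le> n"
    using \<open>d * r \<le> n\<close> by linarith
  then have "\<forall>v\<in>S. \<exists>a w. w \<in> vertices (G d) \<and> a \<in> FI_hom d n \<and> T d n a w = v"
    using generated_in_degree[OF stable] assms(2) by blast
  then obtain a w where aw: "\<And>v. v \<in> S \<Longrightarrow> w v \<in> vertices (G d)"
      "\<And>v. v \<in> S \<Longrightarrow> a v \<in> FI_hom d n" "\<And>v. v \<in> S \<Longrightarrow> T d n (a v) (w v) = v"
    by metis
  have "card (\<Union>v\<in>S. a v ` {1..d}) \<le> (\<Sum>v\<in>S. card (a v ` {1..d}))"
    by (rule card_UN_le[OF \<open>finite S\<close>])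
  also have "\<dots> = (\<Sum>v\<in>S. d)"
    by (intro sum.cong refl FI_hom_card_image[OF aw(2)])
  also have "\<dots> \<le> d * r"
    using \<open>card S \<le> r\<close> by (simp add: mult.commute)
  finally have card: "card (\<Union>v\<in>S. a v ` {1..d}) \<le> d * r" .
  have "(\<Union>v\<in>S. a v ` {1..d}) \<subseteq> {1..n}"
    using FI_hom_image aw(2) by blast
  then obtain c where c: "c \<in> FI_hom (d * r) n" "(\<Union>v\<in>S. a v ` {1..d}) \<subseteq> c ` {1..d * r}"
    by (rule FI_hom_onto_superset[OF _ card \<open>d * r \<le> n\<close>])
  show ?thesis
  proof
    show "S \<subseteq> T (d * r) n c ` vertices (G (d * r))"
    proof
      fix v assume "v \<in> S"
      then have "a v ` {1..d} \<subseteq> c ` {1..d * r}"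
        using c(2) by blast
      then obtain b where b: "b \<in> FI_hom d (d * r)" "a v = compose {1..d} c b"
        by (rule FI_hom_factor_image[OF aw(2)[OF \<open>v \<in> S\<close>] c(1)])
      have "v = T (d * r) n c (T d (d * r) b (w v))"
        using aw(3)[OF \<open>v \<in> S\<close>] composition[OF b(1) c(1) aw(1)[OF \<open>v \<in> S\<close>]] b(2) by simp
      moreover have "T d (d * r) b (w v) \<in> vertices (G (d * r))"
        by (rule T_vertex[OF b(1) aw(1)[OF \<open>v \<in> S\<close>]])
      ultimately show "v \<in> T (d * r) n c ` vertices (G (d * r))" by blast
    qed
  qed (fact c(1))
qed

text \<open>Injectivity on \<open>W\<close> makes \<open>W\<close> and \<open>S\<close> equally
  large, although the whole transition map may identify vertices.\<close>

lemma lift_vertices: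
  assumes stable: "stable_degree_le G T d" and S: "S \<subseteq> vertices (G (n + 1))" "card S \<le> r"
    and "d * r \<le> n" "1 \<le> r"
  obtains f W where "f \<in> FI_hom n (n + 1)" "W \<subseteq> vertices (G n)" "inj_on (T n (n + 1) f) W"
    "T n (n + 1) f ` W = S"
proof -
  let ?l = "d * r" and ?i = "\<lambda>i\<in>{1..d * r}. i"
  obtain c where c: "c \<in> FI_hom ?l (n + 1)" "S \<subseteq> T ?l (n + 1) c ` vertices (G ?l)"
    using common_source[OF stable S] \<open>?l \<le> n\<close> \<open>1 \<le> r\<close> by (metis trans_le_add1)
  have i: "?i \<in> FI_hom ?l n"
    by (rule FI_hom_inclusion[OF \<open>?l \<le> n\<close>])
  \<comment> \<open>Extending \<open>c\<close> along the inclusion of \<open>[d * r]\<close> into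
    \<open>[n]\<close> gives the single map through which all of \<open>S\<close> is
    reached.\<close>
  obtain h where h: "h \<in> FI_hom n (n + 1)" "c = compose {1..?l} h ?i"
    using FI_hom_extend[OF i c(1)] by auto
  have "T ?l (n + 1) c x \<in> T n (n + 1) h ` vertices (G n)" if "x \<in> vertices (G ?l)" for x
    unfolding h(2) composition[OF i h(1) that] using T_vertex[OF i that] by blast
  then have "S \<subseteq> T n (n + 1) h ` vertices (G n)"
    using c(2) by blast
  \<comment> \<open>\<open>W\<close> consists of one chosen preimage for each element of
    \<open>S\<close>.\<close>
  then show ?thesis
    using that h(1) by (metis subset_image_inj)
qed

text \<open>The relation may depend on the level, so that equality and adjacency are both instances.
  One threshold serves all levels because only finitely many pairs at level \<open>d * 2\<close>
  have to be watched.\<close>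

lemma eventually_reflected:
  assumes "vertex_stable G T"
    and pres: "\<And>n m f x y. \<lbrakk>f \<in> FI_hom n m; x \<in> vertices (G n); y \<in> vertices (G n); R n x y\<rbrakk>
      \<Longrightarrow> R m (T n m f x) (T n m f y)"
  obtains N where "\<And>n m f x y. \<lbrakk>N \<le> n; f \<in> FI_hom n m; x \<in> vertices (G n); y \<in> vertices (G n);
      R m (T n m f x) (T n m f y)\<rbrakk> \<Longrightarrow> R n x y"
proof -
  obtain d where stable: "stable_degree_le G T d"
    using assms(1) by (auto simp: vertex_stable_def)
  let ?l = "d * 2"
  let ?R = "\<lambda>k g x y. R k (T ?l k g x) (T ?l k g y)"
  let ?V = "vertices (G ?l)"
  \<comment> \<open>The threshold for a pair is any level at which some injection makes it related;
    for a pair that is never related the claim is vacuous.\<close>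
  have "\<exists>N. \<forall>n\<ge>N. \<forall>k. \<forall>g\<in>FI_hom ?l k. ?R k g (fst p) (snd p) \<longrightarrow>
      (\<forall>g'\<in>FI_hom ?l n. ?R n g' (fst p) (snd p))" if p: "p \<in> ?V \<times> ?V" for p
  proof (cases "\<exists>k. \<exists>g\<in>FI_hom ?l k. ?R k g (fst p) (snd p)")
    case True
    then obtain k g where g: "g \<in> FI_hom ?l k" "?R k g (fst p) (snd p)" by blast
    have "?R n g' (fst p) (snd p)" if "k \<le> n" "g' \<in> FI_hom ?l n" for n g'
    proof -
      \<comment> \<open>Every later injection \<open>g'\<close> extends the witness
        \<open>g\<close>, so preservation along \<open>h\<close> carries the relation to level
        \<open>n\<close>.\<close>
      obtain h where h: "h \<in> FI_hom k n" "g' = compose {1..?l} h g"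
        using FI_hom_extend[OF g(1) \<open>g' \<in> FI_hom ?l n\<close> \<open>k \<le> n\<close>] .
      show ?thesis
        using p pres[OF h(1) _ _ g(2)] T_vertex[OF g(1)] composition[OF g(1) h(1)]
        unfolding h(2) by auto
    qed
    then show ?thesis by blast
  qed blast
  then obtain N where N: "\<And>p n k g g'. \<lbrakk>p \<in> ?V \<times> ?V; N p \<le> n; g \<in> FI_hom ?l k;
      ?R k g (fst p) (snd p); g' \<in> FI_hom ?l n\<rbrakk> \<Longrightarrow> ?R n g' (fst p) (snd p)"
    by metis
  have fin: "finite (N ` (?V \<times> ?V))"
    using graph[of ?l] by (simp add: simple_graph_def)
  show ?thesis
  proof
    fix n m f x y
    assume n: "max ?l (Max (N ` (?V \<times> ?V))) \<le> n" and f: "f \<in> FI_hom n m"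
      and xy: "x \<in> vertices (G n)" "y \<in> vertices (G n)" and R: "R m (T n m f x) (T n m f y)"
    \<comment> \<open>Only an upper bound holds, since \<open>x\<close> and \<open>y\<close> may
      coincide.\<close>
    have "card {x, y} \<le> 2"
      by (simp add: card_insert_if)
    then obtain c where c: "c \<in> FI_hom ?l n" "{x, y} \<subseteq> T ?l n c ` ?V"
      using common_source[OF stable, of "{x, y}" n 2] xy n by auto
    then obtain x' y' where x': "x' \<in> ?V" "x = T ?l n c x'" and y': "y' \<in> ?V" "y = T ?l n c y'"
      by blast
    have "N (x', y') \<le> n"
      using Max_ge[OF fin, of "N (x', y')"] x' y' n by auto
    \<comment> \<open>The pair \<open>(x', y')\<close> is thus related at some level, namely
      \<open>m\<close>. As \<open>n\<close> is past its threshold, it is also related at level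
      \<open>n\<close> under \<open>c\<close>, which is the claim for \<open>x\<close> and
      \<open>y\<close>.\<close>
    moreover have "?R m (compose {1..?l} f c) x' y'"
      using R x' y' composition[OF c(1) f] by simp
    ultimately show "R n x y"
      using N[of "(x', y')" n "compose {1..?l} f c" m c] FI_hom_compose[OF c(1) f] c(1) x' y' by simp
  qed
qed

text \<open>Images of edges are edges of \<open>G m\<close> and so keep two elements, which makes
  the image a simple graph. Reflection of adjacency then makes it induced.\<close>

lemma induced_subgraph_image:
  assumes f: "f \<in> FI_hom n m"
    and reflect: "\<And>x y. \<lbrakk>x \<in> vertices (G n); y \<in> vertices (G n);
      {T n m f x, T n m f y} \<in> edges (G m)\<rbrakk> \<Longrightarrow> {x, y} \<in> edges (G n)"
  shows "induced_subgraph (graph_image (T n m f) (G n)) (G m)"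
proof -
  let ?H = "graph_image (T n m f) (G n)"
  have edge: "e \<subseteq> vertices ?H \<and> e \<in> edges (G m)" if e: "e \<in> edges ?H" for e
  proof -
    obtain e' where e': "e' \<in> edges (G n)" "e = T n m f ` e'"
      using e by (auto simp: graph_image_def)
    then obtain x y where "e' = {x, y}" "x \<in> vertices (G n)" "y \<in> vertices (G n)"
      using edgeE by metis
    then show ?thesis
      using e' T_edge[OF f] by (auto simp: graph_image_def)
  qed
  have "vertices ?H \<subseteq> vertices (G m)"
    using T_vertex[OF f] by (auto simp: graph_image_def)
  moreover have "finite (vertices ?H)"
    using graph[of n] by (simp add: graph_image_def simple_graph_def)
  ultimately have "subgraph ?H (G m)"
    using edge graph[of m] unfolding subgraph_def simple_graph_def by blast
  moreover have "{T n m f x, T n m f y} \<in> edges ?H"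
    if "x \<in> vertices (G n)" "y \<in> vertices (G n)" "{T n m f x, T n m f y} \<in> edges (G m)" for x y
    using imageI[OF reflect[OF that], of "(`) (T n m f)"] by (simp add: graph_image_def)
  ultimately show ?thesis
    unfolding induced_subgraph_def by (auto simp: graph_image_def)
qed

text \<open>The two ends of \<open>e\<close> lift together along one map, to two distinct vertices,
  and reflection makes the lifted pair an edge.\<close>

lemma lift_edge:
  assumes stable: "stable_degree_le G T d" and "d * 2 \<le> n" and e: "e \<in> edges (G (n + 1))"
    and reflect: "\<And>f x y. \<lbrakk>f \<in> FI_hom n (n + 1); x \<in> vertices (G n); y \<in> vertices (G n);
      {T n (n + 1) f x, T n (n + 1) f y} \<in> edges (G (n + 1))\<rbrakk> \<Longrightarrow> {x, y} \<in> edges (G n)"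
  shows "\<exists>f\<in>FI_hom n (n + 1). \<exists>e'\<in>edges (G n). T n (n + 1) f ` e' = e"
proof -
  have "e \<subseteq> vertices (G (n + 1))" "card e = 2"
    using e graph[of "n + 1"] by (auto simp: simple_graph_def)
  then obtain f W where f: "f \<in> FI_hom n (n + 1)" and W: "W \<subseteq> vertices (G n)"
      "inj_on (T n (n + 1) f) W" "T n (n + 1) f ` W = e"
    by (rule lift_vertices[OF stable _ eq_refl \<open>d * 2 \<le> n\<close> one_le_numeral])
  then have "card W = 2"
    using \<open>card e = 2\<close> card_image by metis
  then obtain x y where "W = {x, y}"
    by (auto simp: card_2_iff)
  then have "W \<in> edges (G n)"
    using reflect[OF f, of x y] W e by auto
  then show ?thesis
    using f W by blast
qed

end

theorem theorem1:
  fixes G :: "nat \<Rightarrow> 'a sgraph"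
    and T :: "nat \<Rightarrow> nat \<Rightarrow> (nat \<Rightarrow> nat) \<Rightarrow> 'a \<Rightarrow> 'a"
  assumes "FI_graph G T"
    and "vertex_stable G T"
  shows "(\<exists>N. \<forall>n\<ge>N.
            (\<forall>m. \<forall>f\<in>FI_hom n m. inj_on (T n m f) (vertices (G n))) \<and>
            (\<forall>m. \<forall>f\<in>FI_hom n m. induced_subgraph (graph_image (T n m f) (G n)) (G m)) \<and>
            (\<forall>e\<in>edges (G (n + 1)). \<exists>f\<in>FI_hom n (n + 1). \<exists>e'\<in>edges (G n).
                T n (n + 1) f ` e' = e)) \<and>
         (\<forall>r\<ge>1. \<exists>N. \<forall>n\<ge>N. \<forall>S. S \<subseteq> vertices (G (n + 1)) \<and> card S = r \<longrightarrow>
            (\<exists>W. W \<subseteq> vertices (G n) \<and> card W = r \<and>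
              (\<exists>f\<in>FI_hom n (n + 1). T n (n + 1) f ` W = S)))"
proof -
  interpret FI_graph G T by (fact assms(1))
  obtain d where stable: "stable_degree_le G T d"
    using assms(2) by (auto simp: vertex_stable_def)
  obtain N1 where N1: "\<And>n m f x y. \<lbrakk>N1 \<le> n; f \<in> FI_hom n m; x \<in> vertices (G n);
      y \<in> vertices (G n); T n m f x = T n m f y\<rbrakk> \<Longrightarrow> x = y"
    \<comment> \<open>Preservation is trivial for equality; for adjacency, treated next, it is the
      homomorphism property.\<close>
    by (rule eventually_reflected[OF assms(2), of "\<lambda>_ x y. x = y"]) auto
  obtain N2 where N2: "\<And>n m f x y. \<lbrakk>N2 \<le> n; f \<in> FI_hom n m; x \<in> vertices (G n);
      y \<in> vertices (G n); {T n m f x, T n m f y} \<in> edges (G m)\<rbrakk> \<Longrightarrow> {x, y} \<in> edges (G n)"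
    by (rule eventually_reflected[OF assms(2), of "\<lambda>n x y. {x, y} \<in> edges (G n)"])
      (auto intro: T_edge)
  show ?thesis
  proof (intro conjI)
    show "\<exists>N. \<forall>n\<ge>N.
        (\<forall>m. \<forall>f\<in>FI_hom n m. inj_on (T n m f) (vertices (G n))) \<and>
        (\<forall>m. \<forall>f\<in>FI_hom n m. induced_subgraph (graph_image (T n m f) (G n)) (G m)) \<and>
        (\<forall>e\<in>edges (G (n + 1)). \<exists>f\<in>FI_hom n (n + 1). \<exists>e'\<in>edges (G n).
            T n (n + 1) f ` e' = e)"
    \<comment> \<open>\<open>N1\<close> serves injectivity and \<open>N2\<close> inducedness;
      lifting edges uses \<open>N2\<close> together with \<open>d * 2\<close>, the bound for lifting
      two vertices.\<close>
    proof (rule exI[of _ "max (d * 2) (max N1 N2)"], intro allI impI conjI ballI)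
      fix n m f assume "max (d * 2) (max N1 N2) \<le> n" "f \<in> FI_hom n m"
      then show "inj_on (T n m f) (vertices (G n))"
        using N1 by (intro inj_onI) auto
    next
      fix n m f assume "max (d * 2) (max N1 N2) \<le> n" "f \<in> FI_hom n m"
      then show "induced_subgraph (graph_image (T n m f) (G n)) (G m)"
        using N2 by (intro induced_subgraph_image) auto
    next
      fix n e assume "max (d * 2) (max N1 N2) \<le> n" "e \<in> edges (G (n + 1))"
      then show "\<exists>f\<in>FI_hom n (n + 1). \<exists>e'\<in>edges (G n). T n (n + 1) f ` e' = e"
        using N2 by (intro lift_edge[OF stable]) auto
    qed
  next
    show "\<forall>r\<ge>1. \<exists>N. \<forall>n\<ge>N. \<forall>S. S \<subseteq> vertices (G (n + 1)) \<and> card S = r \<longrightarrow>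
        (\<exists>W. W \<subseteq> vertices (G n) \<and> card W = r \<and> (\<exists>f\<in>FI_hom n (n + 1). T n (n + 1) f ` W = S))"
    proof (intro allI impI)
      fix r :: nat assume "1 \<le> r"
      show "\<exists>N. \<forall>n\<ge>N. \<forall>S. S \<subseteq> vertices (G (n + 1)) \<and> card S = r \<longrightarrow>
          (\<exists>W. W \<subseteq> vertices (G n) \<and> card W = r \<and> (\<exists>f\<in>FI_hom n (n + 1). T n (n + 1) f ` W = S))"
      proof (intro exI[of _ "d * r"] allI impI)
        fix n S assume "d * r \<le> n" and S: "S \<subseteq> vertices (G (n + 1)) \<and> card S = r"
        then obtain f W where "f \<in> FI_hom n (n + 1)" "W \<subseteq> vertices (G n)"
            "inj_on (T n (n + 1) f) W" "T n (n + 1) f ` W = S"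
          using lift_vertices[OF stable _ eq_refl \<open>d * r \<le> n\<close> \<open>1 \<le> r\<close>, of S] by blast
        then show "\<exists>W. W \<subseteq> vertices (G n) \<and> card W = r \<and>
            (\<exists>f\<in>FI_hom n (n + 1). T n (n + 1) f ` W = S)"
          using S card_image by metis
      qed
    qed
  qed
qed

end
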